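(* Let $R$ be a unique factorization domain with quotient field $Q(R)$, and let $f(s)=\frac{a_m}{m^s}+\cdots+\frac{a_n}{n^s}$ be an algebraically primitive Dirichlet polynomial with coefficients in $R$, $a_ma_n\neq0$. Suppose that for a prime element $p$ of $R$ either (i) $p\mid a_i$ for each $i=m,\dots,n-1$, $p\nmid a_n$ and $p^2\nmid a_m$; or (ii) $p\mid a_i$ for each $i=m+1,\dots,n$, $p\nmid a_m$ and $p^2\nmid a_n$. Then $f$ is irreducible over $Q(R)$.
   Context: Dirichlet polynomials $\sum_i \frac{a_i}{i^s}$ (finite sums, $i$ positive integers) are multiplied by the Dirichlet product $\left(\sum_j\frac{b_j}{j^s}\right)\left(\sum_k\frac{c_k}{k^s}\right)=\sum_i\frac{\sum_{jk=i}b_jc_k}{i^s}$; a constant Dirichlet polynomial is one supported on $\{1\}$. $f$ is algebraically primitive if the indices $i$ with $a_i\neq0$ have gcd $1$. "Irreducible over $Q(R)$" means $f$ cannot be written as a product of two nonconstant Dirichlet polynomials with coefficients in $Q(R)$. *)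

theory Defs
  imports "HOL-Computational_Algebra.Polynomial_Factorial"
begin

(* The Dirichlet polynomial with coefficients a i at the terms 1/i^s is encoded by its
   coefficient function a; positivity of the indices becomes the convention a 0 = 0. *)
definition dirichlet_poly :: "(nat \<Rightarrow> 'a::zero) \<Rightarrow> bool" where
  "dirichlet_poly a \<longleftrightarrow> finite {i. a i \<noteq> 0} \<and> a 0 = 0"

(* For i > 0 the index set is finite.  For i = 0 it is infinite, so the sum is 0 by
   convention, in accordance with the convention on the coefficient at 0. *)
definition dirichlet_mult :: "(nat \<Rightarrow> 'a::comm_semiring_0) \<Rightarrow> (nat \<Rightarrow> 'a) \<Rightarrow> nat \<Rightarrow> 'a" where
  "dirichlet_mult b c = (\<lambda>i. \<Sum>(j, k) \<in> {(j, k). j * k = i}. b j * c k)"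

definition dirichlet_constant :: "(nat \<Rightarrow> 'a::zero) \<Rightarrow> bool" where
  "dirichlet_constant a \<longleftrightarrow> {i. a i \<noteq> 0} \<subseteq> {1}"

definition algebraically_primitive :: "(nat \<Rightarrow> 'a::zero) \<Rightarrow> bool" where
  "algebraically_primitive a \<longleftrightarrow> Gcd {i. a i \<noteq> 0} = 1"

(* With this notion constants are irreducible. *)
definition dirichlet_irreducible :: "(nat \<Rightarrow> 'k::field) \<Rightarrow> bool" where
  "dirichlet_irreducible f \<longleftrightarrow>
     \<not> (\<exists>g h. dirichlet_poly g \<and> dirichlet_poly h \<and>
          \<not> dirichlet_constant g \<and> \<not> dirichlet_constant h \<and> f = dirichlet_mult g h)"

definition irreducible_over_quotient_field :: "(nat \<Rightarrow> 'a::idom) \<Rightarrow> bool" where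
  "irreducible_over_quotient_field a \<longleftrightarrow> dirichlet_irreducible (\<lambda>i. to_fract (a i))"

end

theory Submission
  imports Defs
begin

text \<open>
  Clear denominators in a factorization over the quotient field and divide out the powers of \<open>p\<close>,
  so that \<open>D * a\<close> is the Dirichlet product of \<open>b\<close> and \<open>c\<close> over the ring, where neither \<open>b\<close> nor
  \<open>c\<close> vanishes modulo \<open>p\<close>. The products of the largest, and of the smallest, indices of \<open>b\<close> and
  \<open>c\<close> that survive modulo \<open>p\<close> are indices at which \<open>a\<close> survives, hence both equal the only such
  index, \<open>n\<close> in case (i) and \<open>m\<close> in case (ii); so modulo \<open>p\<close> both factors are monomials. If
  neither \<open>b\<close> nor \<open>c\<close> is itself a monomial, then their coefficients at the opposite end are both
  divisible by \<open>p\<close>, so \<open>p\<^sup>2\<close> divides the coefficient of \<open>a\<close> there. A monomial factor is constant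
  because its index divides all indices of \<open>a\<close>.
\<close>

section \<open>Terms and divisibility of a Dirichlet product\<close>

lemma mult_eq_mult_imp_eq:
  fixes j k j' k' :: nat
  assumes "j \<le> j'" "k \<le> k'" "j * k = j' * k'" "0 < j * k"
  shows "j = j' \<and> k = k'"
proof -
  have "j * k \<le> j * k'" "j * k' \<le> j' * k'" using assms(1,2) by auto
  then have "j * k = j * k'" "j * k' = j' * k'" using assms by linarith+
  moreover have "0 < j" "0 < k'" using assms by (auto intro!: Nat.gr0I)
  ultimately show ?thesis by simp
qed

lemma finite_factor_pairs:
  "0 < i \<Longrightarrow> finite {(j, k). j * k = (i::nat)}"
  by (rule finite_subset[of _ "{..i} \<times> {..i}"]) (auto simp: dvd_imp_le)

lemma dirichlet_mult_commute: "dirichlet_mult b c = dirichlet_mult c b"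
proof
  fix i
  show "dirichlet_mult b c i = dirichlet_mult c b i"
    unfolding dirichlet_mult_def
    by (rule sum.reindex_bij_witness[of _ prod.swap prod.swap]) (auto simp: mult.commute)
qed

lemma dirichlet_mult_scale:
  "dirichlet_mult (\<lambda>j. x * b j) (\<lambda>k. y * c k) i = x * y * dirichlet_mult b c i"
  unfolding dirichlet_mult_def by (simp add: sum_distrib_left case_prod_unfold mult_ac)

lemma dirichlet_mult_to_fract:
  "dirichlet_mult (\<lambda>j. to_fract (b j)) (\<lambda>k. to_fract (c k)) i = to_fract (dirichlet_mult b c i)"
  unfolding dirichlet_mult_def by (simp add: to_fract_sum case_prod_unfold)

lemma not_dvd_dirichlet_multE:
  fixes b c :: "nat \<Rightarrow> 'a::comm_ring_1"
  assumes "\<not> q dvd dirichlet_mult b c i"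
  obtains j k where "j * k = i" "\<not> q dvd b j" "\<not> q dvd c k"
proof -
  obtain z where "z \<in> {(j, k). j * k = i}" "\<not> q dvd (case z of (j, k) \<Rightarrow> b j * c k)"
    using assms unfolding dirichlet_mult_def by (meson dvd_sum)
  then show thesis using that by (auto intro: dvd_mult dvd_mult2)
qed

text \<open>Modulo \<open>q\<close> a single term of the defining sum is left, so the coefficient
  and that term are divisible by \<open>q\<close> together.\<close>

lemma dvd_dirichlet_mult_iff:
  fixes b c :: "nat \<Rightarrow> 'a::comm_ring_1"
  assumes "0 < J * K"
    and "\<And>j k. j * k = J * K \<Longrightarrow> (j, k) \<noteq> (J, K) \<Longrightarrow> q dvd b j * c k"
  shows "q dvd dirichlet_mult b c (J * K) \<longleftrightarrow> q dvd b J * c K"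
proof -
  let ?S = "{(j, k). j * k = J * K}"
  have "dirichlet_mult b c (J * K) = b J * c K + (\<Sum>(j, k) \<in> ?S - {(J, K)}. b j * c k)"
    unfolding dirichlet_mult_def
    by (subst sum.remove[of ?S "(J, K)"]) (use assms(1) in \<open>auto intro: finite_factor_pairs\<close>)
  moreover have "q dvd (\<Sum>(j, k) \<in> ?S - {(J, K)}. b j * c k)"
    using assms(2) by (intro dvd_sum) auto
  ultimately show ?thesis by (simp add: dvd_add_left_iff)
qed

section \<open>Extreme indices modulo \<open>q\<close>, and the supports of the factors\<close>

context
  fixes b c :: "nat \<Rightarrow> 'a::comm_ring_1" and q :: 'a and B C :: "nat set"
  assumes b: "dirichlet_poly b" and c: "dirichlet_poly c"
    and B_def: "B = {j. \<not> q dvd b j}" and C_def: "C = {k. \<not> q dvd c k}"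
    and ne: "B \<noteq> {}" "C \<noteq> {}"
begin

lemma finite_support_mod: "finite B" "finite C"
proof -
  have "B \<subseteq> {j. b j \<noteq> 0}" "C \<subseteq> {k. c k \<noteq> 0}" unfolding B_def C_def by auto
  then show "finite B" "finite C" using b c unfolding dirichlet_poly_def by (auto intro: finite_subset)
qed

lemma support_mod_pos: "j \<in> B \<Longrightarrow> 0 < j" "k \<in> C \<Longrightarrow> 0 < k"
  using b c unfolding dirichlet_poly_def B_def C_def by (auto intro!: Nat.gr0I)

text \<open>Indices that survive modulo \<open>q\<close> are bounded by the maxima, so a pair of
  them whose product is the product of the maxima consists of the maxima. The modulus is kept
  arbitrary: a prime element gives reduction modulo \<open>p\<close>, and \<open>q = 0\<close> gives
  the true supports.\<close>

lemma dvd_dirichlet_mult_Max: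
  "q dvd dirichlet_mult b c (Max B * Max C) \<longleftrightarrow> q dvd b (Max B) * c (Max C)"
proof (rule dvd_dirichlet_mult_iff)
  show pos: "0 < Max B * Max C"
    using support_mod_pos finite_support_mod ne by simp
  fix j k assume jk: "j * k = Max B * Max C" "(j, k) \<noteq> (Max B, Max C)"
  have "\<not> (j \<in> B \<and> k \<in> C)"
  proof
    assume "j \<in> B \<and> k \<in> C"
    then have "j \<le> Max B" "k \<le> Max C" using finite_support_mod by auto
    then show False using mult_eq_mult_imp_eq[of j "Max B" k "Max C"] jk pos by simp
  qed
  then show "q dvd b j * c k" unfolding B_def C_def by auto
qed

lemma dvd_dirichlet_mult_Min:
  "q dvd dirichlet_mult b c (Min B * Min C) \<longleftrightarrow> q dvd b (Min B) * c (Min C)"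
proof (rule dvd_dirichlet_mult_iff)
  show pos: "0 < Min B * Min C"
    using support_mod_pos finite_support_mod ne by simp
  fix j k assume jk: "j * k = Min B * Min C" "(j, k) \<noteq> (Min B, Min C)"
  have "\<not> (j \<in> B \<and> k \<in> C)"
  proof
    assume "j \<in> B \<and> k \<in> C"
    then have "Min B \<le> j" "Min C \<le> k" using finite_support_mod by auto
    then show False using mult_eq_mult_imp_eq[of "Min B" j "Min C" k] jk pos by simp
  qed
  then show "q dvd b j * c k" unfolding B_def C_def by auto
qed

end

text \<open>Primality lets the product coefficients at both extreme index products survive, so both
  products must be \<open>r\<close>; positivity then forces each minimum to equal the maximum. Thus
  \<open>b\<close> and \<open>c\<close> determine \<open>r\<close>.\<close>

lemma prime_elem_mult_support_singleton:
  fixes b c :: "nat \<Rightarrow> 'a::idom"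
  assumes p: "prime_elem p" and b: "dirichlet_poly b" and c: "dirichlet_poly c"
    and ne: "{j. \<not> p dvd b j} \<noteq> {}" "{k. \<not> p dvd c k} \<noteq> {}"
    and r: "\<And>i. i \<noteq> r \<Longrightarrow> p dvd dirichlet_mult b c i"
  obtains j0 k0 where "{j. \<not> p dvd b j} = {j0}" "{k. \<not> p dvd c k} = {k0}" "j0 * k0 = r"
proof -
  define B C where BC: "B = {j. \<not> p dvd b j}" "C = {k. \<not> p dvd c k}"
  note ctx = b c BC ne[folded BC]
  note fin = finite_support_mod[OF ctx]
  note mem = Max_in[OF fin(1)] Max_in[OF fin(2)] Min_in[OF fin(1)] Min_in[OF fin(2)]
  have nd: "\<not> p dvd b j * c k" if "j \<in> B" "k \<in> C" for j k
    using that p by (auto simp: BC prime_elem_dvd_mult_iff)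
  have Max: "Max B * Max C = r"
    using dvd_dirichlet_mult_Max[OF ctx] r nd mem ctx(5,6) by blast
  have "Min B * Min C = r"
    using dvd_dirichlet_mult_Min[OF ctx] r nd mem ctx(5,6) by blast
  moreover have "Min B \<le> Max B" "Min C \<le> Max C" "0 < Min B" "0 < Min C"
    using fin mem support_mod_pos[OF ctx] ctx(5,6) by auto
  ultimately have eq: "Min B = Max B" "Min C = Max C"
    using mult_eq_mult_imp_eq[of "Min B" "Max B" "Min C" "Max C"] Max by auto
  have "j = Max B" if "j \<in> B" for j using Max_ge[OF fin(1) that] Min_le[OF fin(1) that] eq(1) by simp
  then have "B = {Max B}" using mem(1) ctx(5) by blast
  moreover have "k = Max C" if "k \<in> C" for k using Max_ge[OF fin(2) that] Min_le[OF fin(2) that] eq(2) by simp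
  then have "C = {Max C}" using mem(2) ctx(6) by blast
  ultimately show thesis using that Max unfolding BC by blast
qed

lemma extreme_indices_dirichlet_mult:
  fixes b c :: "nat \<Rightarrow> 'a::idom"
  assumes b: "dirichlet_poly b" and c: "dirichlet_poly c"
    and supp: "{i. dirichlet_mult b c i \<noteq> 0} \<subseteq> {m..n}"
    and mn: "dirichlet_mult b c m \<noteq> 0" "dirichlet_mult b c n \<noteq> 0"
  shows "Max {j. b j \<noteq> 0} * Max {k. c k \<noteq> 0} = n"
    and "Min {j. b j \<noteq> 0} * Min {k. c k \<noteq> 0} = m"
proof -
  define B C where "B = {j. b j \<noteq> 0}" "C = {k. c k \<noteq> 0}"
  \<comment> \<open>Divisibility by 0 means being 0, so the results modulo \<open>q\<close> apply to
    the supports themselves.\<close>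
  then have BC: "B = {j. \<not> 0 dvd b j}" "C = {k. \<not> 0 dvd c k}" by auto
  obtain j k where jk: "j * k = m" "j \<in> B" "k \<in> C"
    using mn(1) not_dvd_dirichlet_multE[of 0 b c m] BC by auto
  obtain j' k' where jk': "j' * k' = n" "j' \<in> B" "k' \<in> C"
    using mn(2) not_dvd_dirichlet_multE[of 0 b c n] BC by auto
  have ne: "B \<noteq> {}" "C \<noteq> {}" using jk by auto
  note ctx = b c BC ne
  note fin = finite_support_mod[OF ctx]
  note mem = Max_in[OF fin(1) ne(1)] Max_in[OF fin(2) ne(2)]
    Min_in[OF fin(1) ne(1)] Min_in[OF fin(2) ne(2)]
  have "dirichlet_mult b c (Max B * Max C) \<noteq> 0"
    using dvd_dirichlet_mult_Max[OF ctx] mem BC by auto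
  then have "Max B * Max C \<le> n" using supp by auto
  moreover have "n \<le> Max B * Max C"
    using jk' fin by (auto intro: mult_le_mono)
  ultimately show "Max {j. b j \<noteq> 0} * Max {k. c k \<noteq> 0} = n" using BC by simp
  have "dirichlet_mult b c (Min B * Min C) \<noteq> 0"
    using dvd_dirichlet_mult_Min[OF ctx] mem BC by auto
  then have "m \<le> Min B * Min C" using supp by auto
  moreover have "Min B * Min C \<le> m"
    using jk fin by (auto intro: mult_le_mono)
  ultimately show "Min {j. b j \<noteq> 0} * Min {k. c k \<noteq> 0} = m" using BC by simp
qed

section \<open>Powers of \<open>p\<close> and denominators\<close>

lemma divide_out_prime_elem:
  fixes b :: "nat \<Rightarrow> 'a::{idom, factorial_semiring}"
  assumes p: "prime_elem p" and "b j \<noteq> 0"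
  obtains e b' where "b = (\<lambda>j. p ^ e * b' j)" "{j. \<not> p dvd b' j} \<noteq> {}"
proof -
  let ?P = "\<lambda>e. \<forall>j. p ^ e dvd b j"
  \<comment> \<open>The multiplicity of \<open>p\<close> in the nonzero coefficient
    \<open>b j\<close> bounds the exponents of all common powers, so a greatest one exists.\<close>
  have bound: "e \<le> multiplicity p (b j)" if "?P e" for e
    using assms that by (auto intro!: multiplicity_geI)
  define e where "e = Greatest ?P"
  have "?P e" unfolding e_def by (rule GreatestI_nat[where k = 0, OF _ bound]) auto
  then have "\<forall>j. \<exists>y. b j = p ^ e * y" by (simp add: dvd_def)
  then obtain b' where b': "\<And>j. b j = p ^ e * b' j" by (auto dest!: choice)
  have "\<not> (\<forall>j. p dvd b' j)"
  proof
    assume "\<forall>j. p dvd b' j"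
    then have "?P (Suc e)" by (simp add: b' mult.commute mult_dvd_mono)
    then have "Suc e \<le> Greatest ?P" by (rule Greatest_le_nat[where P = ?P, OF _ bound])
    then show False by (simp add: e_def)
  qed
  then show thesis using that b' by auto
qed

text \<open>Induction over the finite support multiplies the denominators together; off the support
  the numerator is 0.\<close>

lemma common_denominator:
  fixes g :: "nat \<Rightarrow> 'a::idom fract"
  assumes "dirichlet_poly g"
  obtains d b where "d \<noteq> 0" "dirichlet_poly b" "\<And>j. to_fract (b j) = to_fract d * g j"
proof -
  have "\<exists>d::'a. d \<noteq> 0 \<and> (\<forall>j\<in>S. to_fract d * g j \<in> range to_fract)" if "finite S" for S
    using that
  proof induction
    case empty
    show ?case by (auto intro: exI[of _ 1])
  next
    case (insert x S)
    then obtain d where d: "d \<noteq> 0" "\<forall>j\<in>S. to_fract d * g j \<in> range to_fract" by blast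
    obtain u v where uv: "g x = Fract u v" "v \<noteq> 0" by (cases "g x")
    have "to_fract (v * d) * g x = to_fract (d * u)"
      using uv by (simp add: to_fract_def eq_fract mult_ac)
    then have "to_fract (v * d) * g x \<in> range to_fract" by (rule range_eqI)
    moreover have "to_fract (v * d) * g j \<in> range to_fract" if j: "j \<in> S" for j
    proof -
      obtain w where "to_fract d * g j = to_fract w" using d(2) j by auto
      then have "to_fract (v * d) * g j = to_fract (v * w)" by (simp add: mult.assoc)
      then show ?thesis by (rule range_eqI)
    qed
    ultimately show ?case using d(1) uv(2) by (intro exI[of _ "v * d"]) (simp del: to_fract_mult)
  qed
  then obtain d :: 'a where d: "d \<noteq> 0" "\<forall>j\<in>{j. g j \<noteq> 0}. to_fract d * g j \<in> range to_fract"
    using assms unfolding dirichlet_poly_def by blast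
  have "\<forall>j. \<exists>y. to_fract y = to_fract d * g j"
  proof
    fix j
    show "\<exists>y. to_fract y = to_fract d * g j"
    proof (cases "g j = 0")
      case False
      then have "to_fract d * g j \<in> range to_fract" using d(2) by simp
      then show ?thesis by (metis imageE)
    qed (auto intro: exI[of _ 0])
  qed
  then obtain b where b: "\<And>j. to_fract (b j) = to_fract d * g j" by metis
  have "b j = 0 \<longleftrightarrow> g j = 0" for j
    using b[of j] d(1) by (metis mult_eq_0_iff to_fract_eq_0_iff)
  then have "dirichlet_poly b" using assms unfolding dirichlet_poly_def by simp
  then show thesis using that d b by blast
qed

section \<open>Monomial factors and the Eisenstein argument\<close>

lemma dirichlet_constant_if_monomial_factor:
  fixes g h :: "nat \<Rightarrow> 'a::comm_ring_1"
  assumes "algebraically_primitive (dirichlet_mult g h)" and "{j. g j \<noteq> 0} \<subseteq> {J}"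
  shows "dirichlet_constant g"
proof -
  have "J dvd i" if nz: "dirichlet_mult g h i \<noteq> 0" for i
  proof -
    obtain j k where "j * k = i" "g j \<noteq> 0"
      using nz by (auto elim: not_dvd_dirichlet_multE[of 0 g h i, simplified])
    then show ?thesis using assms(2) by auto
  qed
  then have "J dvd Gcd {i. dirichlet_mult g h i \<noteq> 0}" by (auto intro: Gcd_greatest)
  then show ?thesis using assms unfolding algebraically_primitive_def dirichlet_constant_def by auto
qed

text \<open>The pair \<open>(r, s)\<close> treats both cases at once: \<open>r\<close> is the end
  where \<open>a\<close> survives modulo \<open>p\<close>, \<open>s\<close> the opposite end. The
  factor \<open>D\<close> stems from clearing denominators.\<close>

lemma eisenstein_monomial_factor:
  fixes a b c :: "nat \<Rightarrow> 'a::{idom, factorial_semiring}"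
  assumes p: "prime_elem p" and b: "dirichlet_poly b" and c: "dirichlet_poly c"
    and D: "D \<noteq> 0" and mult: "\<And>i. dirichlet_mult b c i = D * a i"
    and supp: "{i. a i \<noteq> 0} \<subseteq> {m..n}" and nz: "a m \<noteq> 0" "a n \<noteq> 0"
    and rs: "(r, s) = (n, m) \<or> (r, s) = (m, n)"
    and r: "\<And>i. i \<noteq> r \<Longrightarrow> p dvd a i" "\<not> p dvd a r" and s: "\<not> p\<^sup>2 dvd a s"
  shows "\<exists>J. {j. b j \<noteq> 0} \<subseteq> {J} \<or> {k. c k \<noteq> 0} \<subseteq> {J}"
proof -
  have "\<exists>j k. b j \<noteq> 0 \<and> c k \<noteq> 0"
    using not_dvd_dirichlet_multE[of 0 b c m] mult[of m] D nz by auto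
  then obtain j k where "b j \<noteq> 0" "c k \<noteq> 0" by blast
  obtain e b' where b': "b = (\<lambda>j. p ^ e * b' j)" "{j. \<not> p dvd b' j} \<noteq> {}"
    using divide_out_prime_elem[of p b j] p \<open>b j \<noteq> 0\<close> by blast
  obtain e' c' where c': "c = (\<lambda>k. p ^ e' * c' k)" "{k. \<not> p dvd c' k} \<noteq> {}"
    using divide_out_prime_elem[of p c k] p \<open>c k \<noteq> 0\<close> by blast
  have p0: "p \<noteq> 0" using p by auto
  have supp': "{j. b j \<noteq> 0} = {j. b' j \<noteq> 0}" "{k. c k \<noteq> 0} = {k. c' k \<noteq> 0}"
    using p0 unfolding b'(1) c'(1) by auto
  have poly: "dirichlet_poly b'" "dirichlet_poly c'"
    using b c p0 unfolding dirichlet_poly_def supp' by (auto simp: b'(1) c'(1))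
  have mult': "p ^ (e + e') * dirichlet_mult b' c' i = D * a i" for i
    using mult[of i] unfolding b'(1) c'(1) dirichlet_mult_scale by (simp add: power_add)
  \<comment> \<open>Since \<open>p\<close> does not divide \<open>a r\<close>, the whole power of
    \<open>p\<close> passes to \<open>D\<close> and can be cancelled.\<close>
  have "p ^ (e + e') dvd D * a r" using mult'[of r] by (metis dvd_triv_left)
  then have "p ^ (e + e') dvd D" using p r(2) prime_power_dvd_multD[of p "e + e'" "a r" D]
    by (cases "e + e' = 0") (auto simp: mult.commute)
  then obtain D' where D': "D = p ^ (e + e') * D'" by blast
  have eq: "dirichlet_mult b' c' i = D' * a i" for i
    using mult'[of i] p0 unfolding D' by (simp add: mult.assoc)
  have D'0: "D' \<noteq> 0" using D D' by auto
  obtain j0 k0 where jk0: "{j. \<not> p dvd b' j} = {j0}" "{k. \<not> p dvd c' k} = {k0}" "j0 * k0 = r"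
    using prime_elem_mult_support_singleton[OF p poly b'(2) c'(2), of r] r(1) unfolding eq by auto
  have pD': "\<not> p dvd D'"
  proof
    \<comment> \<open>Then every coefficient of the product vanishes modulo \<open>p\<close>, so any
      index may play the part of \<open>r\<close>; \<open>Suc r\<close> contradicts
      \<open>j0 * k0 = r\<close>.\<close>
    assume "p dvd D'"
    then obtain j k where "{j. \<not> p dvd b' j} = {j}" "{k. \<not> p dvd c' k} = {k}" "j * k = Suc r"
      using prime_elem_mult_support_singleton[OF p poly b'(2) c'(2), of "Suc r"] unfolding eq by auto
    then show False using jk0 by simp
  qed
  define B C where BC: "B = {j. b' j \<noteq> 0}" "C = {k. c' k \<noteq> 0}"
  have ends: "Max B * Max C = n" "Min B * Min C = m"
    using extreme_indices_dirichlet_mult[OF poly, of m n] supp nz D'0 unfolding eq BC by auto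
  have fin: "finite B" "finite C" using poly unfolding BC dirichlet_poly_def by auto
  have mem: "j0 \<in> B" "k0 \<in> C" using jk0(1,2) unfolding BC by force+
  have B: "Min B \<le> j" "j \<le> Max B" if "j \<in> B" for j using fin that by auto
  have C: "Min C \<le> k" "k \<le> Max C" if "k \<in> C" for k using fin that by auto
  have pos: "0 < j" if "j \<in> B \<or> j \<in> C" for j
    using that poly unfolding BC dirichlet_poly_def by (auto intro!: Nat.gr0I)
  show ?thesis
  proof (rule ccontr)
    assume "\<not> ?thesis"
    then have nonmono: "\<not> B \<subseteq> {J}" "\<not> C \<subseteq> {J}" for J unfolding supp' BC by auto
    have lt: "Min B \<noteq> Max B" "Min C \<noteq> Max C"
      using nonmono[of "Max B"] B nonmono[of "Max C"] C by fastforce+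
    \<comment> \<open>If both coefficients are nonzero, then \<open>j\<close> and \<open>k\<close>
      lie at the ends of the supports belonging to \<open>s\<close>, while \<open>j0\<close> and
      \<open>k0\<close> lie at the opposite ends. These differ for non-monomials, so
      \<open>p\<close> divides each coefficient.\<close>
    have div: "p\<^sup>2 dvd b' j * c' k" if jk: "j * k = s" for j k
    proof (cases "j \<in> B \<and> k \<in> C")
      case False
      then show ?thesis unfolding BC by auto
    next
      case True
      have pos': "0 < j0 * k0" "0 < Min B * Min C" "0 < j * k"
        using pos mem True Min_in fin by auto
      have "j \<noteq> j0 \<and> k \<noteq> k0"
        using rs
      proof
        assume "(r, s) = (n, m)"
        then have "j = Min B \<and> k = Min C" "j0 = Max B \<and> k0 = Max C"
          using mult_eq_mult_imp_eq[of "Min B" j "Min C" k]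
            mult_eq_mult_imp_eq[of j0 "Max B" k0 "Max C"] ends jk jk0(3) True mem B C pos'
          by auto
        then show ?thesis using lt by auto
      next
        assume "(r, s) = (m, n)"
        then have "j = Max B \<and> k = Max C" "j0 = Min B \<and> k0 = Min C"
          using mult_eq_mult_imp_eq[of j "Max B" k "Max C"]
            mult_eq_mult_imp_eq[of "Min B" j0 "Min C" k0] ends jk jk0(3) True mem B C pos'
          by auto
        then show ?thesis using lt by auto
      qed
      then have "p dvd b' j" "p dvd c' k" using jk0 by blast+
      then show ?thesis by (simp add: power2_eq_square mult_dvd_mono)
    qed
    have "p\<^sup>2 dvd dirichlet_mult b' c' s"
      unfolding dirichlet_mult_def using div by (intro dvd_sum) auto
    then have "p\<^sup>2 dvd a s" using prime_power_dvd_multD[OF p, of 2 D' "a s"] pD' unfolding eq by simp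
    then show False using s by blast
  qed
qed

theorem theorem2p14:
  fixes a :: "nat \<Rightarrow> 'a::{idom, factorial_semiring}"
    and p :: 'a
    and m n :: nat
  assumes "dirichlet_poly a"
    and "1 \<le> m" and "m \<le> n"
    and "{i. a i \<noteq> 0} \<subseteq> {m..n}"
    and "a m * a n \<noteq> 0"
    and "algebraically_primitive a"
    and "prime_elem p"
    and "((\<forall>i\<in>{m..<n}. p dvd a i) \<and> \<not> p dvd a n \<and> \<not> p\<^sup>2 dvd a m) \<or>
         ((\<forall>i\<in>{m<..n}. p dvd a i) \<and> \<not> p dvd a m \<and> \<not> p\<^sup>2 dvd a n)"
  shows "irreducible_over_quotient_field a"
  unfolding irreducible_over_quotient_field_def dirichlet_irreducible_def
proof safe
  fix g h
  assume g: "dirichlet_poly g" "\<not> dirichlet_constant g"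
    and h: "dirichlet_poly h" "\<not> dirichlet_constant h"
    and fact: "(\<lambda>i. to_fract (a i)) = dirichlet_mult g h"
  obtain d b where b: "d \<noteq> 0" "dirichlet_poly b" "\<And>j. to_fract (b j) = to_fract d * g j"
    using common_denominator[OF g(1)] by blast
  obtain d' c where c: "d' \<noteq> 0" "dirichlet_poly c" "\<And>j. to_fract (c j) = to_fract d' * h j"
    using common_denominator[OF h(1)] by blast
  have "to_fract (dirichlet_mult b c i) = to_fract (d * d' * a i)" for i
    using dirichlet_mult_to_fract[of b c i] fun_cong[OF fact, of i]
    by (simp add: b(3) c(3) dirichlet_mult_scale)
  then have mult: "dirichlet_mult b c i = d * d' * a i" for i by (simp only: to_fract_eq_iff)
  \<comment> \<open>Outside \<open>{m..n}\<close> the coefficients are 0, so divisibility by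
    \<open>p\<close> extends to every index except \<open>r\<close>.\<close>
  have "\<exists>r s. ((r, s) = (n, m) \<or> (r, s) = (m, n)) \<and>
      (\<forall>i. i \<noteq> r \<longrightarrow> p dvd a i) \<and> \<not> p dvd a r \<and> \<not> p\<^sup>2 dvd a s"
    using assms(8)
  proof
    assume *: "(\<forall>i\<in>{m..<n}. p dvd a i) \<and> \<not> p dvd a n \<and> \<not> p\<^sup>2 dvd a m"
    have "p dvd a i" if "i \<noteq> n" for i
      using * assms(4) that by (cases "a i = 0") auto
    then show ?thesis using * by blast
  next
    assume *: "(\<forall>i\<in>{m<..n}. p dvd a i) \<and> \<not> p dvd a m \<and> \<not> p\<^sup>2 dvd a n"
    have "p dvd a i" if "i \<noteq> m" for i
      using * assms(4) that by (cases "a i = 0") auto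
    then show ?thesis using * by blast
  qed
  then obtain r s where rs: "(r, s) = (n, m) \<or> (r, s) = (m, n)"
    "\<And>i. i \<noteq> r \<Longrightarrow> p dvd a i" "\<not> p dvd a r" "\<not> p\<^sup>2 dvd a s" by blast
  have "d * d' \<noteq> 0" "a m \<noteq> 0" "a n \<noteq> 0" using b c assms(5) by auto
  from eisenstein_monomial_factor[OF assms(7) b(2) c(2) this(1) mult assms(4) this(2,3) rs]
  obtain J where J: "{j. b j \<noteq> 0} \<subseteq> {J} \<or> {k. c k \<noteq> 0} \<subseteq> {J}" by blast
  \<comment> \<open>Scaling by the nonzero \<open>d\<close> and \<open>d'\<close> keeps the
    supports, so a monomial factor over the ring comes from one over the quotient field.\<close>
  have "{j. b j \<noteq> 0} = {j. g j \<noteq> 0}" "{k. c k \<noteq> 0} = {k. h k \<noteq> 0}"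
    using b c by (metis mult_eq_0_iff to_fract_eq_0_iff)+
  moreover have "algebraically_primitive (dirichlet_mult g h)"
    using assms(6) unfolding fact[symmetric] algebraically_primitive_def by simp
  ultimately show False
    using J g(2) h(2) dirichlet_constant_if_monomial_factor dirichlet_mult_commute by metis
qed

end
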